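(* Let $G$ be a finite group of order $k$ and let $M_k(\mathbb{C})$ have its $G$-crossed product grading. For every $n\ge1$, the space $P_n^G\cap \mathrm{Id}^G(M_k(\mathbb{C}))$ of $G$-graded identities in $P_n^G$ is spanned over $\mathbb{Q}$ by the binomial identities $m-\pi(m)$, where $m$ runs over strongly multilinear monomials in $P_n^G$ and $\pi$ over initial product preserving permutations for $m$. In particular, the binomial identities generate the $T$-ideal $\mathrm{Id}^G(M_k(\mathbb{C}))$ of $G$-graded identities for $M_k(\mathbb{C})$.
   Context: Crossed product grading: let $G$ be a finite group of order $k$, and index the rows and columns of $k\times k$ matrices by the elements of $G$ (with respect to some ordering of $G$). Let $e_h$ ($h\in G$) be the diagonal matrix unit at position $(h,h)$, and let $D_k$ be the set of diagonal matrices in $M_k(\mathbb{C})$. For $g\in G$ let $P_g$ be the permutation matrix sending the standard basis vector indexed by $h$ to the one indexed by $gh$; thus $P_gP_h=P_{gh}$, and $P_g\left(\sum_h a_he_h\right)P_g^{-1}=\sum_h a_he_{gh}$. The $G$-crossed product grading is $M_k(\mathbb{C})=\bigoplus_{g\in G}D_kP_g$, with $g$-component $D_kP_g$. Graded identities: let $\mathbb{Q}\langle X^G\rangle$ be the free associative algebra over $\mathbb{Q}$ on the noncommuting variables $x_{i,g}$, $i\ge1$, $g\in G$, graded by $G$ with $x_{i,g}$ of degree $g$. A polynomial in it is a $G$-graded identity for $M_k(\mathbb{C})$ if it vanishes whenever each variable $x_{i,g}$ is replaced by an arbitrary element of $D_kP_g$. The set $\mathrm{Id}^G(M_k(\mathbb{C}))$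 of all such identities is a $T$-ideal, i.e. an ideal stable under every $G$-graded endomorphism of $\mathbb{Q}\langle X^G\rangle$; a set generates it as a $T$-ideal if it is the smallest $T$-ideal containing the set. $P_n^G$ is the $\mathbb{Q}$-span of the strongly multilinear monomials $x_{i_1,g_1}\cdots x_{i_n,g_n}$ with $\{i_1,\dots,i_n\}=\{1,\dots,n\}$ and $g_1,\dots,g_n\in G$ arbitrary. For such a monomial $m$ and $\pi\in S_n$ put $\pi(m)=x_{i_{\pi(1)},g_{\pi(1)}}\cdots x_{i_{\pi(n)},g_{\pi(n)}}$. The permutation $\pi$ is initial product preserving for $m$ if (1) $g_1g_2\cdots g_n=g_{\pi(1)}g_{\pi(2)}\cdots g_{\pi(n)}$, and (2) for every $1\le i\le n$, if $\pi^{-1}(i)=j$ then $g_1g_2\cdots g_i=g_{\pi(1)}g_{\pi(2)}\cdots g_{\pi(j)}$. A binomial identity is a polynomial $m-\pi(m)$ with $m$ strongly multilinear and $\pi$ initial product preserving for $m$. *)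

theory Defs
  imports
    "HOL-Library.Poly_Mapping"
    "HOL-Algebra.Ideal"
    "HOL-Combinatorics.Permutations"
    "Jordan_Normal_Form.Matrix"
begin

subsection \<open>The free associative algebra over the rationals\<close>

text \<open>The free monoid, wrapped in its own type so that the convolution product of
  \<^type>\<open>poly_mapping\<close> becomes the product of noncommutative polynomials.\<close>

datatype 'v nc_monom = Monom (letters: "'v list")

instantiation nc_monom :: (type) monoid_add
begin

definition zero_nc_monom :: "'a nc_monom" where
  "0 = Monom []"

definition plus_nc_monom :: "'a nc_monom \<Rightarrow> 'a nc_monom \<Rightarrow> 'a nc_monom" where
  "u + v = Monom (letters u @ letters v)"

instance
  by standard (simp_all add: zero_nc_monom_def plus_nc_monom_def)

end

type_synonym 'v nc_poly = "'v nc_monom \<Rightarrow>\<^sub>0 rat"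

definition monom_poly :: "'v nc_monom \<Rightarrow> 'v nc_poly" where
  "monom_poly m = Poly_Mapping.single m 1"

definition qscale :: "rat \<Rightarrow> 'v nc_poly \<Rightarrow> 'v nc_poly" where
  "qscale c f = Poly_Mapping.single 0 c * f"

interpretation nc_poly: vector_space "qscale :: rat \<Rightarrow> 'v nc_poly \<Rightarrow> 'v nc_poly"
  by standard
    (simp_all add: qscale_def distrib_left distrib_right single_add mult_single
      flip: mult.assoc)

text \<open>The pair \<open>(i, g)\<close> is the variable \<open>x_{i,g}\<close>. Monomials and polynomials over
  the type of all pairs are cut down to indices \<open>i \<ge> 1\<close> and degrees in the group.\<close>

definition graded_monoms :: "('g, 'm) monoid_scheme \<Rightarrow> (nat \<times> 'g) nc_monom set" where
  "graded_monoms G = {m. set (letters m) \<subseteq> {1..} \<times> carrier G}"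

definition free_alg :: "('g, 'm) monoid_scheme \<Rightarrow> (nat \<times> 'g) nc_poly ring" where
  "free_alg G = \<lparr>carrier = {f. Poly_Mapping.keys f \<subseteq> graded_monoms G},
     monoid.mult = (*), one = 1, zero = 0, add = (+)\<rparr>"

definition list_prod :: "('g, 'm) monoid_scheme \<Rightarrow> 'g list \<Rightarrow> 'g" where
  "list_prod G gs = foldr (\<otimes>\<^bsub>G\<^esub>) gs \<one>\<^bsub>G\<^esub>"

definition degrees :: "(nat \<times> 'g) nc_monom \<Rightarrow> 'g list" where
  "degrees m = map snd (letters m)"

definition free_component ::
  "('g, 'm) monoid_scheme \<Rightarrow> 'g \<Rightarrow> (nat \<times> 'g) nc_poly set" where
  "free_component G g =
     {f \<in> carrier (free_alg G). \<forall>m\<in>Poly_Mapping.keys f. list_prod G (degrees m) = g}"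

definition graded_endomorphism ::
  "('g, 'm) monoid_scheme \<Rightarrow> ((nat \<times> 'g) nc_poly \<Rightarrow> (nat \<times> 'g) nc_poly) \<Rightarrow> bool" where
  "graded_endomorphism G \<phi> \<longleftrightarrow>
     \<phi> \<in> Ring.ring_hom (free_alg G) (free_alg G) \<and>
     (\<forall>c. \<forall>f\<in>carrier (free_alg G). \<phi> (qscale c f) = qscale c (\<phi> f)) \<and>
     (\<forall>g\<in>carrier G. \<phi> ` free_component G g \<subseteq> free_component G g)"

text \<open>Ideals are automatically rational subspaces, since the algebra has a unit.\<close>

definition T_ideal :: "('g, 'm) monoid_scheme \<Rightarrow> (nat \<times> 'g) nc_poly set \<Rightarrow> bool" where
  "T_ideal G I \<longleftrightarrow>
     ideal I (free_alg G) \<and> (\<forall>\<phi>. graded_endomorphism G \<phi> \<longrightarrow> \<phi> ` I \<subseteq> I)"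

definition generates_T_ideal ::
  "('g, 'm) monoid_scheme \<Rightarrow> (nat \<times> 'g) nc_poly set \<Rightarrow> (nat \<times> 'g) nc_poly set \<Rightarrow> bool" where
  "generates_T_ideal G S I \<longleftrightarrow>
     T_ideal G I \<and> S \<subseteq> I \<and> (\<forall>J. T_ideal G J \<and> S \<subseteq> J \<longrightarrow> I \<subseteq> J)"


subsection \<open>The crossed product grading and its graded identities\<close>

text \<open>The list \<open>hs\<close> enumerates the group without repetition; row and column \<open>i\<close> of
  a matrix are indexed by \<open>hs ! i\<close>. Column \<open>h\<close> of the matrix of \<open>g\<close> has its only
  nonzero entry in row \<open>gh\<close>.\<close>

definition perm_matrix ::
  "('g, 'm) monoid_scheme \<Rightarrow> 'g list \<Rightarrow> 'g \<Rightarrow> complex mat" where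
  "perm_matrix G hs g =
     mat (order G) (order G) (\<lambda>(i, j). if hs ! i = g \<otimes>\<^bsub>G\<^esub> hs ! j then 1 else 0)"

definition crossed_component ::
  "('g, 'm) monoid_scheme \<Rightarrow> 'g list \<Rightarrow> 'g \<Rightarrow> complex mat set" where
  "crossed_component G hs g =
     {D * perm_matrix G hs g | D. D \<in> carrier_mat (order G) (order G) \<and> diagonal_mat D}"

definition eval_monom :: "nat \<Rightarrow> ('v \<Rightarrow> complex mat) \<Rightarrow> 'v nc_monom \<Rightarrow> complex mat" where
  "eval_monom k \<sigma> m = foldr (\<lambda>v M. \<sigma> v * M) (letters m) (1\<^sub>m k)"

text \<open>The sum of matrices over the terms of the polynomial is written entrywise, as
  matrices of unspecified size do not form an additive monoid.\<close>

definition eval_poly :: "nat \<Rightarrow> ('v \<Rightarrow> complex mat) \<Rightarrow> 'v nc_poly \<Rightarrow> complex mat" where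
  "eval_poly k \<sigma> f = mat k k (\<lambda>(i, j).
     \<Sum>m\<in>Poly_Mapping.keys f. of_rat (Poly_Mapping.lookup f m) * eval_monom k \<sigma> m $$ (i, j))"

definition graded_identities ::
  "('g, 'm) monoid_scheme \<Rightarrow> 'g list \<Rightarrow> (nat \<times> 'g) nc_poly set" where
  "graded_identities G hs = {f \<in> carrier (free_alg G). \<forall>\<sigma>.
     (\<forall>i\<ge>1. \<forall>g\<in>carrier G. \<sigma> (i, g) \<in> crossed_component G hs g) \<longrightarrow>
     eval_poly (order G) \<sigma> f = 0\<^sub>m (order G) (order G)}"


subsection \<open>Strongly multilinear polynomials and binomial identities\<close>

definition strongly_multilinear ::
  "('g, 'm) monoid_scheme \<Rightarrow> nat \<Rightarrow> (nat \<times> 'g) nc_monom set" where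
  "strongly_multilinear G n =
     {m \<in> graded_monoms G. length (letters m) = n \<and> fst ` set (letters m) = {1..n}}"

definition P_space :: "('g, 'm) monoid_scheme \<Rightarrow> nat \<Rightarrow> (nat \<times> 'g) nc_poly set" where
  "P_space G n = nc_poly.span (monom_poly ` strongly_multilinear G n)"

text \<open>Positions in a monomial are counted from \<open>0\<close>, so that the symmetric group acts on
  \<open>{..<n}\<close>; letter \<open>j\<close> of the permuted monomial is letter \<open>\<pi> j\<close> of the original one.\<close>

definition permute_monom :: "(nat \<Rightarrow> nat) \<Rightarrow> 'v nc_monom \<Rightarrow> 'v nc_monom" where
  "permute_monom \<pi> m = Monom (permute_list \<pi> (letters m))"

definition initial_product_preserving ::
  "('g, 'm) monoid_scheme \<Rightarrow> (nat \<times> 'g) nc_monom \<Rightarrow> (nat \<Rightarrow> nat) \<Rightarrow> bool" where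
  "initial_product_preserving G m \<pi> \<longleftrightarrow>
     list_prod G (degrees m) = list_prod G (degrees (permute_monom \<pi> m)) \<and>
     (\<forall>i < length (letters m). \<forall>j. Hilbert_Choice.inv \<pi> i = j \<longrightarrow>
        list_prod G (take (Suc i) (degrees m)) =
        list_prod G (take (Suc j) (degrees (permute_monom \<pi> m))))"

definition binomial_identities ::
  "('g, 'm) monoid_scheme \<Rightarrow> nat \<Rightarrow> (nat \<times> 'g) nc_poly set" where
  "binomial_identities G n = {monom_poly m - monom_poly (permute_monom \<pi> m) | m \<pi>.
     m \<in> strongly_multilinear G n \<and> \<pi> permutes {..<n} \<and> initial_product_preserving G m \<pi>}"

end

theory Submission
  imports
    Defs
    "HOL-Library.Countable_Set"
    "HOL-Computational_Algebra.Polynomial"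
    "HOL-Computational_Algebra.Primes"
begin

text \<open>Substitute for each variable \<open>x_{i,g}\<close> the generic element
  \<open>\<Sum>\<^sub>h a_{i,g,h} e_h P_g\<close> of its component. Row \<open>h\<close> of the value of
  \<open>x_{i_1,g_1} \<dots> x_{i_n,g_n}\<close> has a single nonzero entry. It stands in column
  \<open>(g_1 \<dots> g_n)\<^sup>-\<^sup>1 h\<close>, and it is the commutative monomial in the \<open>a\<close>'s whose
  \<open>t\<close>-th factor has indices \<open>i_t\<close>, \<open>g_t\<close> and \<open>(g_1 \<dots> g_{t-1})\<^sup>-\<^sup>1 h\<close>.
  Hence two monomials have the same generic value iff they have the same
  total degree and the same multiset of letters marked with the product of the degrees before
  them. This pair is the signature of a monomial.

  Distinct commutative monomials are linearly independent functions of the entries, so a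
  polynomial is a graded identity iff its coefficients sum to zero over each
  signature class (\<open>graded_identity_class_sums_zero\<close>). Such a polynomial is a combination of
  differences \<open>m - m'\<close> of its own monomials with equal signatures
  (\<open>graded_identity_in_span_differences\<close>), whether it is multilinear or not.

  A bijection that matches equal marked letters turns equality of signatures into an initial
  product preserving permutation (\<open>signature_eq_imp_permute_monom\<close>). So for strongly
  multilinear monomials the differences are exactly the binomial identities, which is the
  statement about \<open>P_n\<close>. For arbitrary monomials, being initial product preserving depends on
  the sequence of degrees alone, so \<open>m - m'\<close> is obtained from a strongly multilinear binomial
  identity by the graded endomorphism that changes the first indices of the variables back
  (\<open>difference_in_T_ideal\<close>). Every T-ideal containing the binomial identities therefore
  contains all graded identities.\<close>


section \<open>Noncommutative polynomials as combinations of monomials\<close>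

lemma qscale_monom_poly: "qscale c (monom_poly m) = Poly_Mapping.single m c"
  by (simp add: qscale_def monom_poly_def mult_single)

lemma lookup_qscale:
  "Poly_Mapping.lookup (qscale c f) m = c * Poly_Mapping.lookup f m"
  by (simp add: qscale_def Poly_Mapping.map.rep_eq when_def flip: mult_map_scale_conv_mult)

lemma keys_qscale_subset: "Poly_Mapping.keys (qscale c f) \<subseteq> Poly_Mapping.keys f"
  by (auto simp: in_keys_iff lookup_qscale)

lemma monom_poly_zero: "monom_poly 0 = 1"
  by (simp add: monom_poly_def)

lemma monom_poly_plus: "monom_poly (u + v) = monom_poly u * monom_poly v"
  by (simp add: monom_poly_def mult_single)

lemma keys_monom_poly: "Poly_Mapping.keys (monom_poly m) = {m}"
  by (simp add: monom_poly_def)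

lemma nc_poly_expansion:
  "f = (\<Sum>m\<in>Poly_Mapping.keys f. qscale (Poly_Mapping.lookup f m) (monom_poly m))"
  by (rule poly_mapping_eqI)
    (simp add: lookup_sum qscale_monom_poly lookup_single when_def in_keys_iff)

lemma subspace_keys_subset:
  fixes S :: "'a nc_monom set"
  shows "nc_poly.subspace {f. Poly_Mapping.keys f \<subseteq> S}"
proof (rule nc_poly.subspaceI)
  fix c and f g :: "'a nc_poly" assume *: "f \<in> {f. Poly_Mapping.keys f \<subseteq> S}" "g \<in> {f. Poly_Mapping.keys f \<subseteq> S}"
  then show "f + g \<in> {f. Poly_Mapping.keys f \<subseteq> S}"
    using keys_add[of f g] by auto
  show "qscale c f \<in> {f. Poly_Mapping.keys f \<subseteq> S}"
    using * keys_qscale_subset[of c f] by auto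
qed simp

lemma span_monom_poly:
  fixes S :: "'v nc_monom set"
  shows "nc_poly.span (monom_poly ` S) = {f. Poly_Mapping.keys f \<subseteq> S}"
proof
  show "nc_poly.span (monom_poly ` S) \<subseteq> {f. Poly_Mapping.keys f \<subseteq> S}"
    by (rule nc_poly.span_minimal[OF _ subspace_keys_subset]) (auto simp: keys_monom_poly)
  show "{f. Poly_Mapping.keys f \<subseteq> S} \<subseteq> nc_poly.span (monom_poly ` S)"
  proof
    fix f :: "'v nc_poly" assume "f \<in> {f. Poly_Mapping.keys f \<subseteq> S}"
    then have "(\<Sum>m\<in>Poly_Mapping.keys f. qscale (Poly_Mapping.lookup f m) (monom_poly m))
        \<in> nc_poly.span (monom_poly ` S)"
      by (intro nc_poly.span_sum nc_poly.span_scale nc_poly.span_base) auto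
    then show "f \<in> nc_poly.span (monom_poly ` S)"
      using nc_poly_expansion[of f] by simp
  qed
qed

lemma nc_poly_induct [consumes 1, case_names zero monom add scale]:
  assumes "Poly_Mapping.keys f \<subseteq> S"
    and "P 0" and "\<And>m. m \<in> S \<Longrightarrow> P (monom_poly m)"
    and "\<And>f g. \<lbrakk>Poly_Mapping.keys f \<subseteq> S; Poly_Mapping.keys g \<subseteq> S; P f; P g\<rbrakk> \<Longrightarrow> P (f + g)"
    and "\<And>c f. \<lbrakk>Poly_Mapping.keys f \<subseteq> S; P f\<rbrakk> \<Longrightarrow> P (qscale c f)"
  shows "P f"
proof -
  have "nc_poly.subspace {f. Poly_Mapping.keys f \<subseteq> S \<and> P f}"
    using subspace_keys_subset[of S] assms(2,4,5) unfolding nc_poly.subspace_def by auto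
  then have "nc_poly.span (monom_poly ` S) \<subseteq> {f. Poly_Mapping.keys f \<subseteq> S \<and> P f}"
    by (intro nc_poly.span_minimal) (use assms(3) in \<open>auto simp: keys_monom_poly\<close>)
  then show ?thesis
    using assms(1) span_monom_poly[of S] by auto
qed

lemma qscale_mult_left: "qscale c f * g = qscale c (f * g)"
  by (simp add: qscale_def mult.assoc)

lemma qscale_mult_right: "f * qscale c g = qscale c (f * g)"
proof -
  have "Poly_Mapping.keys f \<subseteq> UNIV" by simp
  then show ?thesis
  proof (induction f rule: nc_poly_induct)
    case (monom m)
    \<comment> \<open>The scalars are the constant polynomials, and these commute with monomials.\<close>
    have "monom_poly m * Poly_Mapping.single 0 c = Poly_Mapping.single 0 c * monom_poly m"
      by (simp add: monom_poly_def mult_single)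
    then show ?case
      by (simp add: qscale_def flip: mult.assoc)
  qed (simp_all add: distrib_right nc_poly.scale_right_distrib qscale_mult_left
      nc_poly.scale_left_commute)
qed

lemma sum_keys_qscale:
  assumes "\<And>m. F m 0 = 0"
  shows "(\<Sum>m\<in>Poly_Mapping.keys (qscale c f). F m (Poly_Mapping.lookup (qscale c f) m)) =
    (\<Sum>m\<in>Poly_Mapping.keys f. F m (c * Poly_Mapping.lookup f m))"
  by (intro sum.mono_neutral_cong_left)
    (use keys_qscale_subset in \<open>auto simp: assms lookup_qscale in_keys_iff\<close>)

text \<open>Pick one representative monomial in each class of \<open>sig\<close> and subtract it from every
  monomial of its class. What remains is one multiple of each representative, and its
  coefficient is the class sum.\<close>

lemma in_span_differences_if_class_sums_zero:
  fixes f :: "'v nc_poly"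
  assumes zero: "\<And>s. (\<Sum>m | m \<in> Poly_Mapping.keys f \<and> sig m = s. Poly_Mapping.lookup f m) = 0"
  shows "f \<in> nc_poly.span {monom_poly m - monom_poly m' | m m'.
    m \<in> Poly_Mapping.keys f \<and> m' \<in> Poly_Mapping.keys f \<and> sig m = sig m'}" (is "f \<in> nc_poly.span ?D")
proof -
  let ?K = "Poly_Mapping.keys f" and ?c = "Poly_Mapping.lookup f"
  define r where "r s = (SOME m. m \<in> ?K \<and> sig m = s)" for s
  have r: "r (sig m) \<in> ?K \<and> sig (r (sig m)) = sig m" if "m \<in> ?K" for m
    unfolding r_def by (rule someI[of _ m]) (use that in simp)
  have "(\<Sum>m\<in>?K. qscale (?c m) (monom_poly (r (sig m)))) =
      (\<Sum>s\<in>sig ` ?K. \<Sum>m | m \<in> ?K \<and> sig m = s. qscale (?c m) (monom_poly (r (sig m))))"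
    by (rule sum.image_gen) simp
  also have "\<dots> = (\<Sum>s\<in>sig ` ?K. qscale (\<Sum>m | m \<in> ?K \<and> sig m = s. ?c m) (monom_poly (r s)))"
    by (simp add: nc_poly.scale_sum_left)
  also have "\<dots> = 0"
    by (simp add: zero)
  finally have "f = (\<Sum>m\<in>?K. qscale (?c m) (monom_poly m)) -
      (\<Sum>m\<in>?K. qscale (?c m) (monom_poly (r (sig m))))"
    using nc_poly_expansion[of f] by simp
  also have "\<dots> = (\<Sum>m\<in>?K. qscale (?c m) (monom_poly m - monom_poly (r (sig m))))"
    by (simp add: nc_poly.scale_right_diff_distrib sum_subtractf)
  also have "\<dots> \<in> nc_poly.span ?D"
    by (intro nc_poly.span_sum nc_poly.span_scale nc_poly.span_base) (use r in \<open>auto, metis\<close>)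
  finally show ?thesis .
qed


section \<open>Evaluation of noncommutative polynomials at matrices\<close>

lemma eval_poly_carrier [simp]: "eval_poly k \<sigma> f \<in> carrier_mat k k"
  by (simp add: eval_poly_def)

lemma eval_poly_zero: "eval_poly k \<sigma> 0 = 0\<^sub>m k k"
  by (rule eq_matI) (simp_all add: eval_poly_def)

lemma eval_poly_add: "eval_poly k \<sigma> (f + g) = eval_poly k \<sigma> f + eval_poly k \<sigma> g"
proof (rule eq_matI)
  fix i j assume "i < dim_row (eval_poly k \<sigma> f + eval_poly k \<sigma> g)"
    "j < dim_col (eval_poly k \<sigma> f + eval_poly k \<sigma> g)"
  then show "eval_poly k \<sigma> (f + g) $$ (i, j) = (eval_poly k \<sigma> f + eval_poly k \<sigma> g) $$ (i, j)"
    using setsum_keys_plus_distrib[of "\<lambda>m c. of_rat c * eval_monom k \<sigma> m $$ (i, j)" f g]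
    by (simp add: eval_poly_def of_rat_add distrib_right)
qed (simp_all add: eval_poly_def)

lemma eval_poly_qscale: "eval_poly k \<sigma> (qscale c f) = of_rat c \<cdot>\<^sub>m eval_poly k \<sigma> f"
proof (rule eq_matI)
  fix i j assume "i < dim_row (of_rat c \<cdot>\<^sub>m eval_poly k \<sigma> f)"
    "j < dim_col (of_rat c \<cdot>\<^sub>m eval_poly k \<sigma> f)"
  then show "eval_poly k \<sigma> (qscale c f) $$ (i, j) = (of_rat c \<cdot>\<^sub>m eval_poly k \<sigma> f) $$ (i, j)"
    using sum_keys_qscale[of "\<lambda>m c. of_rat c * eval_monom k \<sigma> m $$ (i, j)" c f]
    by (simp add: eval_poly_def of_rat_mult sum_distrib_left mult.assoc)
qed (simp_all add: eval_poly_def)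

lemma eval_poly_monom_poly:
  assumes "eval_monom k \<sigma> m \<in> carrier_mat k k"
  shows "eval_poly k \<sigma> (monom_poly m) = eval_monom k \<sigma> m"
  by (rule eq_matI) (use assms in \<open>auto simp: eval_poly_def monom_poly_def\<close>)

lemma eval_monom_carrier:
  assumes "\<And>v. v \<in> set (letters m) \<Longrightarrow> \<sigma> v \<in> carrier_mat k k"
  shows "eval_monom k \<sigma> m \<in> carrier_mat k k"
proof -
  have "foldr (\<lambda>v. (*) (\<sigma> v)) xs (1\<^sub>m k) \<in> carrier_mat k k"
    if "\<And>v. v \<in> set xs \<Longrightarrow> \<sigma> v \<in> carrier_mat k k" for xs
    using that
  proof (induction xs)
    case (Cons v xs)
    then show ?case by (auto intro!: mult_carrier_mat[where n = k])
  qed simp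
  then show ?thesis
    using assms by (simp add: eval_monom_def)
qed

lemma eval_monom_zero: "eval_monom k \<sigma> 0 = 1\<^sub>m k"
  by (simp add: eval_monom_def zero_nc_monom_def)

lemma eval_monom_Cons:
  "eval_monom k \<sigma> (Monom (v # vs)) = \<sigma> v * eval_monom k \<sigma> (Monom vs)"
  by (simp add: eval_monom_def)

lemma eval_monom_plus:
  assumes "\<And>v. v \<in> set (letters u) \<Longrightarrow> \<sigma> v \<in> carrier_mat k k"
    and w: "eval_monom k \<sigma> w \<in> carrier_mat k k"
  shows "eval_monom k \<sigma> (u + w) = eval_monom k \<sigma> u * eval_monom k \<sigma> w"
proof -
  have "eval_monom k \<sigma> (Monom xs + w) = eval_monom k \<sigma> (Monom xs) * eval_monom k \<sigma> w"
    if "\<And>v. v \<in> set xs \<Longrightarrow> \<sigma> v \<in> carrier_mat k k" for xs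
    using that
  proof (induction xs)
    case Nil
    then show ?case
      using w eval_monom_zero[of k \<sigma>] by (simp flip: zero_nc_monom_def)
  next
    case (Cons v xs)
    have "Monom (v # xs) + w = Monom (v # letters (Monom xs + w))"
      by (simp add: plus_nc_monom_def)
    then have "eval_monom k \<sigma> (Monom (v # xs) + w) =
        \<sigma> v * (eval_monom k \<sigma> (Monom xs) * eval_monom k \<sigma> w)"
      using Cons by (simp add: eval_monom_Cons)
    also have "\<dots> = \<sigma> v * eval_monom k \<sigma> (Monom xs) * eval_monom k \<sigma> w"
    proof (rule assoc_mult_mat[symmetric])
      show "\<sigma> v \<in> carrier_mat k k" "eval_monom k \<sigma> (Monom xs) \<in> carrier_mat k k"
        using Cons.prems by (auto intro: eval_monom_carrier)
    qed (rule w)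
    finally show ?case by (simp add: eval_monom_Cons)
  qed
  from this[of "letters u"] show ?thesis
    using assms(1) by simp
qed

lemma eval_poly_mult:
  assumes S: "\<And>m v. \<lbrakk>m \<in> S; v \<in> set (letters m)\<rbrakk> \<Longrightarrow> \<sigma> v \<in> carrier_mat k k"
    and f: "Poly_Mapping.keys f \<subseteq> S" and g: "Poly_Mapping.keys g \<subseteq> S"
  shows "eval_poly k \<sigma> (f * g) = eval_poly k \<sigma> f * eval_poly k \<sigma> g"
proof -
  have carrier: "eval_monom k \<sigma> m \<in> carrier_mat k k" if "m \<in> S" for m
    using S that by (blast intro: eval_monom_carrier)
  have left_monom: "eval_poly k \<sigma> (monom_poly u * g) = eval_monom k \<sigma> u * eval_poly k \<sigma> g"
    if u: "u \<in> S" for u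
    using g
  proof (induction g rule: nc_poly_induct)
    case (monom w)
    have "eval_monom k \<sigma> (u + w) = eval_monom k \<sigma> u * eval_monom k \<sigma> w"
      by (rule eval_monom_plus) (use S u carrier monom in auto)
    then show ?case
      using carrier[OF u] carrier[OF monom]
      by (simp add: eval_poly_monom_poly flip: monom_poly_plus)
  qed (use carrier[OF u] in \<open>simp_all add: eval_poly_zero distrib_left eval_poly_add
      eval_poly_qscale qscale_mult_right mult_add_distrib_mat[where n = k and nr = k and nc = k]
      mult_smult_distrib[where n = k and nr = k and nc = k]\<close>)
  show ?thesis
    using f
  proof (induction f rule: nc_poly_induct)
    case (monom u)
    then show ?case by (simp add: left_monom eval_poly_monom_poly carrier)
  next
    case zero
    show ?case
      using left_mult_zero_mat[OF eval_poly_carrier, of k k \<sigma> g] by (simp add: eval_poly_zero)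
  qed (simp_all add: eval_poly_zero distrib_right eval_poly_add
      eval_poly_qscale qscale_mult_left add_mult_distrib_mat[where n = k and nr = k and nc = k]
      mult_smult_assoc_mat[where n = k and nr = k and nc = k])
qed


section \<open>Separating commutative monomials by powers of integers\<close>

text \<open>If all power sums vanish then so do all sums weighted by a polynomial in the nodes;
  the polynomial whose roots are the nodes other than \<open>x\<close> isolates \<open>x\<close>.\<close>

lemma power_sums_zero_imp_node_sum_zero:
  fixes c N :: "'b \<Rightarrow> 'a :: field"
  assumes fin: "finite K" and zero: "\<And>e. (\<Sum>m\<in>K. c m * N m ^ e) = 0"
  shows "(\<Sum>m | m \<in> K \<and> N m = x. c m) = 0"
proof -
  define q where "q = (\<Prod>y\<in>N ` K - {x}. [:- y, 1:])"
  have q: "poly q z = (\<Prod>y\<in>N ` K - {x}. z - y)" for z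
    by (simp add: q_def poly_prod)
  have "(\<Sum>m | m \<in> K \<and> N m = x. c m) * poly q x = (\<Sum>m | m \<in> K \<and> N m = x. c m * poly q (N m))"
    by (simp add: sum_distrib_right)
  also have "\<dots> = (\<Sum>m\<in>K. c m * poly q (N m))"
    by (rule sum.mono_neutral_left) (use fin in \<open>auto simp: q\<close>)
  also have "\<dots> = (\<Sum>m\<in>K. \<Sum>e\<le>degree q. coeff q e * (c m * N m ^ e))"
    by (simp add: poly_altdef sum_distrib_left mult_ac)
  also have "\<dots> = (\<Sum>e\<le>degree q. coeff q e * (\<Sum>m\<in>K. c m * N m ^ e))"
    by (subst sum.swap) (simp add: sum_distrib_left)
  also have "\<dots> = 0"
    by (simp add: zero)
  finally show ?thesis
    using fin by (simp add: q)
qed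

text \<open>Assigning distinct primes to the commuting variables makes distinct commutative
  monomials take distinct values, by unique factorization.\<close>

lemma countable_inj_into_primes:
  assumes "countable A"
  obtains w :: "'a \<Rightarrow> nat" where "inj_on w A" and "\<And>a. prime (w a)"
proof
  let ?w = "\<lambda>a. enumerate {p::nat. prime p} (to_nat_on A a)"
  have "strict_mono (enumerate {p::nat. prime p})"
    by (rule strict_mono_enumerate) (simp add: primes_infinite)
  then have "inj (enumerate {p::nat. prime p})"
    by (rule strict_mono_imp_inj_on)
  then show "inj_on ?w A"
    using comp_inj_on[OF inj_on_to_nat_on[OF assms] inj_on_subset[OF _ subset_UNIV]]
    by (simp add: comp_def)
  show "prime (?w a)" for a
    using enumerate_in_set[OF primes_infinite] by simp
qed

lemma prod_mset_primes_inj: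
  fixes w :: "'a \<Rightarrow> nat"
  assumes "inj_on w A" and "\<And>a. prime (w a)"
    and "set_mset M \<subseteq> A" and "set_mset N \<subseteq> A"
    and "prod_mset (image_mset w M) = prod_mset (image_mset w N)"
  shows "M = N"
proof -
  have "prime_factorization (prod_mset (image_mset w X)) = image_mset w X" for X
    by (rule prime_factorization_prod_mset_primes) (use assms(2) in auto)
  then have "image_mset w M = image_mset w N"
    using assms(5) by metis
  then show ?thesis
    by (rule multiset.inj_map_strong[rotated]) (use assms(1,3,4) in \<open>auto dest: inj_onD\<close>)
qed

section \<open>Generic matrices of the crossed product grading\<close>

locale enumerated_group = group G for G :: "('g, 'm) monoid_scheme" (structure) +
  fixes hs :: "'g list"
  assumes distinct_hs: "distinct hs" and set_hs: "set hs = carrier G"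
begin

lemma order_eq_length: "Coset.order G = length hs"
  using distinct_card[OF distinct_hs] by (simp add: Coset.order_def set_hs)

lemma nth_hs_closed [simp]: "i < Coset.order G \<Longrightarrow> hs ! i \<in> carrier G"
  using nth_mem[of i hs] by (simp add: order_eq_length set_hs)

lemma nth_hs_eq_iff: "\<lbrakk>i < Coset.order G; j < Coset.order G\<rbrakk> \<Longrightarrow> hs ! i = hs ! j \<longleftrightarrow> i = j"
  by (simp add: order_eq_length nth_eq_iff_index_eq distinct_hs)

lemma obtain_index:
  assumes "h \<in> carrier G"
  obtains i where "i < Coset.order G" "hs ! i = h"
  using assms by (metis in_set_conv_nth order_eq_length set_hs)

text \<open>The element of \<open>D_k P_g\<close> whose diagonal factor has entry \<open>d h\<close> in the row of \<open>h\<close>.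
  Indexing the weights by group elements, rather than by positions in \<open>hs\<close>, turns
  conjugation by \<open>P_g\<close> into a translation.\<close>

definition weighted_perm :: "'g \<Rightarrow> ('g \<Rightarrow> complex) \<Rightarrow> complex mat" where
  "weighted_perm g d =
     mat (Coset.order G) (Coset.order G) (\<lambda>(i, j). if hs ! i = g \<otimes> hs ! j then d (hs ! i) else 0)"

lemma weighted_perm_carrier [simp]: "weighted_perm g d \<in> carrier_mat (Coset.order G) (Coset.order G)"
  by (simp add: weighted_perm_def)

lemma weighted_perm_cong:
  "(\<And>h. h \<in> carrier G \<Longrightarrow> d h = d' h) \<Longrightarrow> weighted_perm g d = weighted_perm g d'"
  unfolding weighted_perm_def by (rule cong_mat) (auto, metis nth_hs_closed)

lemma diagonal_times_perm_matrix:
  assumes D: "D \<in> carrier_mat (Coset.order G) (Coset.order G)" "diagonal_mat D"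
    and ij: "i < Coset.order G" "j < Coset.order G"
  shows "(D * perm_matrix G hs g) $$ (i, j) = (if hs ! i = g \<otimes> hs ! j then D $$ (i, i) else 0)"
proof -
  have "(D * perm_matrix G hs g) $$ (i, j) =
      (\<Sum>l = 0..<Coset.order G. D $$ (i, l) * (if hs ! l = g \<otimes> hs ! j then 1 else 0))"
    using D ij by (simp add: perm_matrix_def scalar_prod_def)
  also have "\<dots> = (\<Sum>l = 0..<Coset.order G. if l = i then if hs ! l = g \<otimes> hs ! j then D $$ (i, i) else 0 else 0)"
    by (rule sum.cong) (use D ij in \<open>auto simp: diagonal_mat_def\<close>)
  also have "\<dots> = (if hs ! i = g \<otimes> hs ! j then D $$ (i, i) else 0)"
    using ij by (simp add: sum.delta)
  finally show ?thesis .
qed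

lemma crossed_component_iff:
  "A \<in> crossed_component G hs g \<longleftrightarrow> (\<exists>d. A = weighted_perm g d)"
proof
  assume "A \<in> crossed_component G hs g"
  then obtain D where D: "D \<in> carrier_mat (Coset.order G) (Coset.order G)" "diagonal_mat D"
    and A: "A = D * perm_matrix G hs g"
    by (auto simp: crossed_component_def)
  define idx where "idx = inv_into {..<Coset.order G} ((!) hs)"
  have idx: "idx (hs ! i) = i" if "i < Coset.order G" for i
    unfolding idx_def by (rule inv_into_f_f) (use that in \<open>auto simp: inj_on_def nth_hs_eq_iff\<close>)
  have "A = weighted_perm g (\<lambda>h. D $$ (idx h, idx h))"
  proof (rule eq_matI)
    show "A $$ (i, j) = weighted_perm g (\<lambda>h. D $$ (idx h, idx h)) $$ (i, j)"
      if "i < dim_row (weighted_perm g (\<lambda>h. D $$ (idx h, idx h)))"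
        "j < dim_col (weighted_perm g (\<lambda>h. D $$ (idx h, idx h)))" for i j
      using that diagonal_times_perm_matrix[OF D, of i j g] idx[of i]
      by (auto simp: A weighted_perm_def)
  qed (use D in \<open>simp_all add: A weighted_perm_def perm_matrix_def\<close>)
  then show "\<exists>d. A = weighted_perm g d"
    by (intro exI[of _ "\<lambda>h. D $$ (idx h, idx h)"])
next
  assume "\<exists>d. A = weighted_perm g d"
  then obtain d where A: "A = weighted_perm g d" ..
  define D where "D = mat (Coset.order G) (Coset.order G) (\<lambda>(i, j). if i = j then d (hs ! i) else 0)"
  have D: "D \<in> carrier_mat (Coset.order G) (Coset.order G)" "diagonal_mat D"
    by (auto simp: D_def diagonal_mat_def)
  have "A = D * perm_matrix G hs g"
  proof (rule eq_matI)
    show "A $$ (i, j) = (D * perm_matrix G hs g) $$ (i, j)"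
      if "i < dim_row (D * perm_matrix G hs g)" "j < dim_col (D * perm_matrix G hs g)" for i j
      using that diagonal_times_perm_matrix[OF D, of i j g]
      by (simp add: A weighted_perm_def D_def perm_matrix_def)
  qed (simp_all add: A weighted_perm_def D_def perm_matrix_def)
  then show "A \<in> crossed_component G hs g"
    using D by (auto simp: crossed_component_def)
qed

lemma weighted_perm_one: "1\<^sub>m (Coset.order G) = weighted_perm \<one> (\<lambda>_. 1)"
  by (rule eq_matI) (simp_all add: weighted_perm_def nth_hs_eq_iff)

lemma weighted_perm_mult:
  assumes g: "g \<in> carrier G" and g': "g' \<in> carrier G"
  shows "weighted_perm g d * weighted_perm g' d' =
    weighted_perm (g \<otimes> g') (\<lambda>h. d h * d' (inv g \<otimes> h))"
proof (rule eq_matI)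
  fix i j
  assume "i < dim_row (weighted_perm (g \<otimes> g') (\<lambda>h. d h * d' (inv g \<otimes> h)))"
    "j < dim_col (weighted_perm (g \<otimes> g') (\<lambda>h. d h * d' (inv g \<otimes> h)))"
  then have ij: "i < Coset.order G" "j < Coset.order G"
    by (simp_all add: weighted_perm_def)
  obtain r where r: "r < Coset.order G" "hs ! r = inv g \<otimes> hs ! i"
    using obtain_index[of "inv g \<otimes> hs ! i"] g ij by auto
  have eq_r: "hs ! i = g \<otimes> hs ! l \<longleftrightarrow> l = r" if "l < Coset.order G" for l
    using inv_solve_left[of "hs ! l" g "hs ! i"] g ij that r nth_hs_eq_iff[OF that r(1)] by auto
  have eq_j: "hs ! r = g' \<otimes> hs ! j \<longleftrightarrow> hs ! i = g \<otimes> g' \<otimes> hs ! j"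
    using inv_solve_left'[of "g' \<otimes> hs ! j" g "hs ! i"] g g' ij r by (simp add: m_assoc)
  have "(weighted_perm g d * weighted_perm g' d') $$ (i, j) =
      (\<Sum>l = 0..<Coset.order G. (if hs ! i = g \<otimes> hs ! l then d (hs ! i) else 0) *
        (if hs ! l = g' \<otimes> hs ! j then d' (hs ! l) else 0))"
    using ij by (simp add: weighted_perm_def scalar_prod_def)
  also have "\<dots> = (\<Sum>l = 0..<Coset.order G. if l = r then
      d (hs ! i) * (if hs ! r = g' \<otimes> hs ! j then d' (hs ! r) else 0) else 0)"
    by (rule sum.cong) (auto simp: eq_r)
  also have "\<dots> = weighted_perm (g \<otimes> g') (\<lambda>h. d h * d' (inv g \<otimes> h)) $$ (i, j)"
    using ij r(1) by (simp add: sum.delta weighted_perm_def flip: eq_j r(2))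
  finally show "(weighted_perm g d * weighted_perm g' d') $$ (i, j) =
      weighted_perm (g \<otimes> g') (\<lambda>h. d h * d' (inv g \<otimes> h)) $$ (i, j)" .
qed (simp_all add: weighted_perm_def)

lemma list_prod_closed [simp]: "set gs \<subseteq> carrier G \<Longrightarrow> list_prod G gs \<in> carrier G"
  by (induction gs) (auto simp: list_prod_def)

lemma list_prod_Cons: "list_prod G (g # gs) = g \<otimes> list_prod G gs"
  by (simp add: list_prod_def)

lemma list_prod_append:
  assumes "set gs \<subseteq> carrier G" "set gs' \<subseteq> carrier G"
  shows "list_prod G (gs @ gs') = list_prod G gs \<otimes> list_prod G gs'"
  using assms(1)
proof (induction gs)
  case Nil
  then show ?case using assms(2) by (simp add: list_prod_def[of _ "[]"])
next
  case (Cons g gs)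
  then show ?case using assms(2) by (simp add: list_prod_Cons m_assoc)
qed

lemma degrees_closed: "m \<in> graded_monoms G \<Longrightarrow> set (degrees m) \<subseteq> carrier G"
  by (auto simp: degrees_def graded_monoms_def)

text \<open>Row \<open>h\<close> of a product of weighted permutation matrices has one nonzero entry. Its first
  factor contributes the weight in row \<open>h\<close> and moves to row \<open>g\<^sup>-\<^sup>1 h\<close>, where the second
  factor contributes, and so on. The list records each letter with the row in which it acts.\<close>

primrec letter_rows :: "'g \<Rightarrow> (nat \<times> 'g) list \<Rightarrow> ((nat \<times> 'g) \<times> 'g) list" where
  "letter_rows h [] = []"
| "letter_rows h (v # vs) = (v, h) # letter_rows (inv (snd v) \<otimes> h) vs"


lemma map_fst_letter_rows [simp]: "map fst (letter_rows h vs) = vs"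
  by (induction vs arbitrary: h) auto

lemma length_letter_rows [simp]: "length (letter_rows h vs) = length vs"
  by (induction vs arbitrary: h) auto

lemma take_snd_closed:
  "set vs \<subseteq> UNIV \<times> carrier G \<Longrightarrow> set (take t (map snd vs)) \<subseteq> carrier G"
  by (rule subset_trans[OF set_take_subset]) auto

lemma letter_rows_nth:
  assumes "set vs \<subseteq> UNIV \<times> carrier G" and "h \<in> carrier G" and "t < length vs"
  shows "letter_rows h vs ! t = (vs ! t, inv (list_prod G (take t (map snd vs))) \<otimes> h)"
  using assms
proof (induction vs arbitrary: h t)
  case Nil
  then show ?case by simp
next
  case (Cons v vs)
  show ?case
  proof (cases t)
    case 0
    then show ?thesis using Cons.prems by (simp add: list_prod_def)
  next
    case (Suc t')
    have g: "snd v \<in> carrier G" and vs: "set vs \<subseteq> UNIV \<times> carrier G"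
      using Cons.prems by auto
    have "set (take t' (map snd vs)) \<subseteq> carrier G"
      using vs by (rule take_snd_closed)
    then show ?thesis
      using Cons.IH[of "inv (snd v) \<otimes> h" t'] Cons.prems Suc g vs
      by (simp add: list_prod_Cons inv_mult_group m_assoc)
  qed
qed

lemma letter_rows_shift:
  assumes vs: "set vs \<subseteq> UNIV \<times> carrier G" and h: "h \<in> carrier G"
  shows "letter_rows h vs = map (\<lambda>(v, x). (v, x \<otimes> h)) (letter_rows \<one> vs)"
proof (rule nth_equalityI)
  fix t assume "t < length (letter_rows h vs)"
  moreover have "set (take t (map snd vs)) \<subseteq> carrier G"
    using vs by (rule take_snd_closed)
  ultimately show "letter_rows h vs ! t = map (\<lambda>(v, x). (v, x \<otimes> h)) (letter_rows \<one> vs) ! t"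
    using vs h by (simp add: letter_rows_nth)
qed simp

lemma letter_rows_closed:
  assumes "set vs \<subseteq> UNIV \<times> carrier G" and "h \<in> carrier G"
  shows "set (letter_rows h vs) \<subseteq> (UNIV \<times> carrier G) \<times> carrier G"
  using assms
proof (induction vs arbitrary: h)
  case (Cons v vs)
  then have "snd v \<in> carrier G" by auto
  then show ?case
    using Cons.IH[of "inv (snd v) \<otimes> h"] Cons.prems by simp
qed simp

lemma graded_letters: "m \<in> graded_monoms G \<Longrightarrow> set (letters m) \<subseteq> UNIV \<times> carrier G"
  by (auto simp: graded_monoms_def)

text \<open>The degrees multiply because the underlying permutation matrices do. The weights of
  successive factors are translated as in \<open>weighted_perm_mult\<close>, which is the recursion of
  \<open>letter_rows\<close>.\<close>

lemma eval_monom_weighted_perm: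
  assumes "\<And>v. v \<in> set (letters m) \<Longrightarrow> snd v \<in> carrier G \<and> \<sigma> v = weighted_perm (snd v) (a v)"
  shows "eval_monom (Coset.order G) \<sigma> m =
    weighted_perm (list_prod G (degrees m)) (\<lambda>h. \<Prod>(v, x)\<leftarrow>letter_rows h (letters m). a v x)"
proof -
  have "eval_monom (Coset.order G) \<sigma> (Monom vs) =
      weighted_perm (list_prod G (map snd vs)) (\<lambda>h. \<Prod>(v, x)\<leftarrow>letter_rows h vs. a v x)"
    if "\<And>v. v \<in> set vs \<Longrightarrow> snd v \<in> carrier G \<and> \<sigma> v = weighted_perm (snd v) (a v)" for vs
    using that
  proof (induction vs)
    case Nil
    then show ?case
      by (simp add: eval_monom_def list_prod_def weighted_perm_one)
  next
    case (Cons v vs)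
    have "list_prod G (map snd vs) \<in> carrier G"
      by (rule list_prod_closed) (use Cons.prems in auto)
    then show ?case
      using Cons by (simp add: eval_monom_Cons weighted_perm_mult list_prod_Cons)
  qed
  from this[of "letters m"] show ?thesis
    using assms by (simp add: degrees_def)
qed

definition graded_assignment :: "(nat \<times> 'g \<Rightarrow> complex mat) \<Rightarrow> bool" where
  "graded_assignment \<sigma> \<longleftrightarrow>
     (\<forall>i\<ge>1. \<forall>g\<in>carrier G. \<sigma> (i, g) \<in> crossed_component G hs g)"

lemma graded_identities_iff:
  "f \<in> graded_identities G hs \<longleftrightarrow> Poly_Mapping.keys f \<subseteq> graded_monoms G \<and>
    (\<forall>\<sigma>. graded_assignment \<sigma> \<longrightarrow> eval_poly (Coset.order G) \<sigma> f = 0\<^sub>m (Coset.order G) (Coset.order G))"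
  by (simp add: graded_identities_def graded_assignment_def free_alg_def)

lemma graded_assignment_weights:
  assumes "graded_assignment \<sigma>"
  obtains a where "\<And>v. v \<in> {1..} \<times> carrier G \<Longrightarrow> \<sigma> v = weighted_perm (snd v) (a v)"
proof -
  have "\<forall>v\<in>{1..} \<times> carrier G. \<exists>d. \<sigma> v = weighted_perm (snd v) d"
    using assms by (auto simp: graded_assignment_def crossed_component_iff)
  from bchoice[OF this] show ?thesis
    using that by blast
qed

lemma eval_graded_monom:
  assumes "\<And>v. v \<in> {1..} \<times> carrier G \<Longrightarrow> \<sigma> v = weighted_perm (snd v) (a v)"
    and "m \<in> graded_monoms G"
  shows "eval_monom (Coset.order G) \<sigma> m =
    weighted_perm (list_prod G (degrees m)) (\<lambda>h. \<Prod>(v, x)\<leftarrow>letter_rows h (letters m). a v x)"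
  by (rule eval_monom_weighted_perm) (use assms in \<open>auto simp: graded_monoms_def\<close>)

lemma graded_assignment_carrier:
  assumes "graded_assignment \<sigma>" "m \<in> graded_monoms G" "v \<in> set (letters m)"
  shows "\<sigma> v \<in> carrier_mat (Coset.order G) (Coset.order G)"
proof -
  obtain a where "\<And>v. v \<in> {1..} \<times> carrier G \<Longrightarrow> \<sigma> v = weighted_perm (snd v) (a v)"
    using graded_assignment_weights[OF assms(1)] by blast
  then show ?thesis
    using assms(2,3) by (auto simp: graded_monoms_def)
qed


section \<open>The signature of a monomial\<close>

text \<open>At a generic graded assignment the total degree tells the column of the nonzero entry in
  row \<open>\<one>\<close>, and the multiset is the commutative monomial standing there.\<close>

definition signature :: "(nat \<times> 'g) nc_monom \<Rightarrow> 'g \<times> ((nat \<times> 'g) \<times> 'g) multiset" where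
  "signature m = (list_prod G (degrees m), mset (letter_rows \<one> (letters m)))"

text \<open>The entry in row \<open>h\<close> is governed by the same multiset with all its rows multiplied by
  \<open>h\<close> on the right, so row \<open>\<one>\<close> decides about all rows.\<close>

lemma eval_monom_eq_if_signature_eq:
  assumes \<sigma>: "graded_assignment \<sigma>"
    and m: "m \<in> graded_monoms G" and m': "m' \<in> graded_monoms G"
    and eq: "signature m = signature m'"
  shows "eval_monom (Coset.order G) \<sigma> m = eval_monom (Coset.order G) \<sigma> m'"
proof -
  obtain a where a: "\<And>v. v \<in> {1..} \<times> carrier G \<Longrightarrow> \<sigma> v = weighted_perm (snd v) (a v)"
    using graded_assignment_weights[OF \<sigma>] by blast
  have value_eq: "eval_monom (Coset.order G) \<sigma> u =
      weighted_perm (list_prod G (degrees u)) (\<lambda>h. \<Prod>(v, x)\<leftarrow>letter_rows h (letters u). a v x)"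
    if "u \<in> graded_monoms G" for u
    using a that by (rule eval_graded_monom)
  have weight: "(\<Prod>(v, x)\<leftarrow>letter_rows h (letters u). a v x) =
      prod_mset (image_mset (\<lambda>(v, x). a v (x \<otimes> h)) (snd (signature u)))"
    if "u \<in> graded_monoms G" "h \<in> carrier G" for u h
  proof -
    have "(\<Prod>(v, x)\<leftarrow>letter_rows h (letters u). a v x) =
        (\<Prod>(v, x)\<leftarrow>letter_rows \<one> (letters u). a v (x \<otimes> h))"
      by (subst letter_rows_shift[OF graded_letters[OF that(1)] that(2)])
        (simp add: comp_def case_prod_unfold)
    then show ?thesis
      by (simp add: signature_def flip: mset_map prod_mset_prod_list)
  qed
  show ?thesis
    unfolding value_eq[OF m] value_eq[OF m']
    using eq by (auto simp: weight m m' signature_def intro!: weighted_perm_cong)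
qed

text \<open>Take row \<open>\<one>\<close> of the value of \<open>f\<close> where the generic entries are the \<open>e\<close>-th powers of
  distinct primes. Each monomial of total degree \<open>p\<close> contributes the \<open>e\<close>-th power of an
  integer that determines its multiset. Letting \<open>e\<close> vary separates these integers.\<close>

lemma graded_identity_class_sums_zero:
  assumes f: "f \<in> graded_identities G hs"
  shows "(\<Sum>m | m \<in> Poly_Mapping.keys f \<and> signature m = s. Poly_Mapping.lookup f m) = 0"
proof (cases "s \<in> signature ` Poly_Mapping.keys f")
  case False
  then have "{m \<in> Poly_Mapping.keys f. signature m = s} = {}" by auto
  then show ?thesis by (simp only: sum.empty)
next
  case True
  let ?K = "Poly_Mapping.keys f" and ?c = "Poly_Mapping.lookup f" and ?k = "Coset.order G"
  define A where "A = ((UNIV :: nat set) \<times> carrier G) \<times> carrier G"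
  have "finite (carrier G)"
    using set_hs by (metis List.finite_set)
  then have "countable A"
    unfolding A_def by (intro countable_SIGMA) (auto intro: countable_finite)
  then obtain w :: "(nat \<times> 'g) \<times> 'g \<Rightarrow> nat" where w: "inj_on w A" "\<And>x. prime (w x)"
    using countable_inj_into_primes by blast
  have K: "m \<in> graded_monoms G" if "m \<in> ?K" for m
    using f that by (auto simp: graded_identities_iff)
  have sig_A: "set_mset (snd (signature m)) \<subseteq> A" if "m \<in> ?K" for m
    using letter_rows_closed[OF graded_letters[OF K[OF that]] one_closed]
    by (simp add: signature_def A_def)
  define N where "N m = (of_nat (prod_mset (image_mset w (snd (signature m)))) :: complex)" for m
  obtain m0 where m0: "m0 \<in> ?K" "s = signature m0"
    using True by auto
  define p where "p = list_prod G (degrees m0)"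
  have p: "p \<in> carrier G"
    unfolding p_def by (rule list_prod_closed) (rule degrees_closed[OF K[OF m0(1)]])
  define K' where "K' = {m \<in> ?K. list_prod G (degrees m) = p}"
  \<comment> \<open>The entry in row \<open>\<one>\<close> and column \<open>inv p\<close> sees exactly the monomials of total degree
    \<open>p\<close>.\<close>
  obtain i0 where i0: "i0 < ?k" "hs ! i0 = \<one>"
    using obtain_index[OF one_closed] .
  obtain j0 where j0: "j0 < ?k" "hs ! j0 = inv p"
    using obtain_index[OF inv_closed[OF p]] .
  have "(\<Sum>m\<in>K'. of_rat (?c m) * N m ^ e) = 0" for e
  proof -
    define a where "a v h = (of_nat (w (v, h)) ^ e :: complex)" for v h
    define \<sigma> where "\<sigma> v = weighted_perm (snd v) (a v)" for v
    have "graded_assignment \<sigma>"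
      by (auto simp: graded_assignment_def crossed_component_iff \<sigma>_def)
    then have "eval_poly ?k \<sigma> f = 0\<^sub>m ?k ?k"
      using f by (simp add: graded_identities_iff)
    then have "0 = eval_poly ?k \<sigma> f $$ (i0, j0)"
      using i0 j0 by simp
    also have "\<dots> = (\<Sum>m\<in>?K. of_rat (?c m) * eval_monom ?k \<sigma> m $$ (i0, j0))"
      using i0 j0 by (simp add: eval_poly_def)
    also have "\<dots> = (\<Sum>m\<in>?K. if list_prod G (degrees m) = p then of_rat (?c m) * N m ^ e else 0)"
    proof (rule sum.cong)
      fix m assume m: "m \<in> ?K"
      have "(\<Prod>(v, x)\<leftarrow>letter_rows \<one> (letters m). a v x) = N m ^ e"
      proof -
        have "(\<Prod>x\<leftarrow>xs. of_nat (w x) ^ e) = (of_nat (prod_mset (image_mset w (mset xs))) :: complex) ^ e"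
          for xs
          by (induction xs) (simp_all add: power_mult_distrib)
        then show ?thesis
          by (simp add: N_def signature_def a_def case_prod_unfold)
      qed
      moreover have "\<one> = list_prod G (degrees m) \<otimes> inv p \<longleftrightarrow> list_prod G (degrees m) = p"
        using inv_solve_right[of \<one> "list_prod G (degrees m)" p] p degrees_closed[OF K[OF m]]
        by auto
      ultimately show "of_rat (?c m) * eval_monom ?k \<sigma> m $$ (i0, j0) =
          (if list_prod G (degrees m) = p then of_rat (?c m) * N m ^ e else 0)"
        using i0 j0 eval_graded_monom[of \<sigma> a m] K[OF m]
        by (simp add: \<sigma>_def weighted_perm_def)
    qed simp
    also have "\<dots> = (\<Sum>m\<in>K'. of_rat (?c m) * N m ^ e)"
      by (simp add: K'_def sum.inter_filter)
    finally show ?thesis by simp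
  qed
  then have "(\<Sum>m | m \<in> K' \<and> N m = N m0. (of_rat (?c m) :: complex)) = 0"
    by (intro power_sums_zero_imp_node_sum_zero) (simp_all add: K'_def)
  moreover have "{m. m \<in> K' \<and> N m = N m0} = {m. m \<in> ?K \<and> signature m = s}"
  proof -
    have "snd (signature m) = snd (signature m0)" if "m \<in> ?K" "N m = N m0" for m
    proof (rule prod_mset_primes_inj[OF w sig_A[OF that(1)] sig_A[OF m0(1)]])
      show "prod_mset (image_mset w (snd (signature m))) =
          prod_mset (image_mset w (snd (signature m0)))"
        using that(2) unfolding N_def of_nat_eq_iff .
    qed
    then show ?thesis
      by (auto simp: K'_def m0 p_def N_def signature_def)
  qed
  ultimately show ?thesis
    by (simp flip: of_rat_sum)
qed


section \<open>Initial product preserving permutations\<close>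

lemma permute_monom_graded:
  assumes "m \<in> graded_monoms G" and "\<pi> permutes {..<length (letters m)}"
  shows "permute_monom \<pi> m \<in> graded_monoms G"
  using assms by (simp add: graded_monoms_def permute_monom_def)

lemma degrees_permute_monom:
  "\<pi> permutes {..<length (letters m)} \<Longrightarrow> degrees (permute_monom \<pi> m) = permute_list \<pi> (degrees m)"
  by (simp add: degrees_def permute_monom_def permute_list_map)

text \<open>The row of a letter is the inverse of the product of the degrees before it, whereas the
  initial products include the letter itself. As corresponding letters of the two monomials
  are equal, the last factor cancels, and it makes no difference which product is compared.\<close>

lemma initial_product_preserving_iff:
  assumes m: "m \<in> graded_monoms G" and \<pi>: "\<pi> permutes {..<length (letters m)}"
  shows "initial_product_preserving G m \<pi> \<longleftrightarrow>
    list_prod G (degrees m) = list_prod G (degrees (permute_monom \<pi> m)) \<and>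
    letter_rows \<one> (letters (permute_monom \<pi> m)) = permute_list \<pi> (letter_rows \<one> (letters m))"
proof -
  let ?n = "length (letters m)" and ?m = "permute_monom \<pi> m"
  have m': "?m \<in> graded_monoms G"
    by (rule permute_monom_graded[OF m \<pi>])
  have len: "length (letters ?m) = ?n"
    by (simp add: permute_monom_def)
  have image: "\<pi> j < ?n" if "j < ?n" for j
    using permutes_in_image[OF \<pi>, of j] that by simp
  have initial: "list_prod G (take (Suc t) (degrees u)) =
      list_prod G (take t (degrees u)) \<otimes> snd (letters u ! t)"
    and closed: "list_prod G (take t (degrees u)) \<in> carrier G" "snd (letters u ! t) \<in> carrier G"
    and row: "letter_rows \<one> (letters u) ! t = (letters u ! t, inv (list_prod G (take t (degrees u))))"
    if "u \<in> graded_monoms G" "t < length (letters u)" for u t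
  proof -
    have sub: "set (take t (degrees u)) \<subseteq> carrier G"
      using degrees_closed[OF that(1)] set_take_subset by fast
    then show c: "list_prod G (take t (degrees u)) \<in> carrier G"
      by simp
    show l: "snd (letters u ! t) \<in> carrier G"
      using graded_letters[OF that(1)] nth_mem[OF that(2)] by auto
    show "list_prod G (take (Suc t) (degrees u)) =
        list_prod G (take t (degrees u)) \<otimes> snd (letters u ! t)"
      using that(2) sub l list_prod_append[of "take t (degrees u)" "[snd (letters u ! t)]"]
      by (simp add: degrees_def take_Suc_conv_app_nth list_prod_def[of _ "[_]"])
    show "letter_rows \<one> (letters u) ! t = (letters u ! t, inv (list_prod G (take t (degrees u))))"
      using letter_rows_nth[OF graded_letters[OF that(1)] one_closed that(2)] c
      by (simp add: degrees_def)
  qed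
  have letter: "letters ?m ! j = letters m ! \<pi> j" if "j < ?n" for j
    using that \<pi> by (simp add: permute_monom_def permute_list_nth)
  have "(\<forall>i<?n. \<forall>j. Hilbert_Choice.inv \<pi> i = j \<longrightarrow> list_prod G (take (Suc i) (degrees m)) =
        list_prod G (take (Suc j) (degrees ?m))) \<longleftrightarrow>
      (\<forall>j<?n. list_prod G (take (Suc (\<pi> j)) (degrees m)) = list_prod G (take (Suc j) (degrees ?m)))"
    (is "?preserving \<longleftrightarrow> ?initial")
  proof
    assume ?preserving
    then show ?initial
      using image permutes_inverses(2)[OF \<pi>] by blast
  next
    assume init: ?initial
    show ?preserving
    proof (intro allI impI)
      fix i j assume ij: "i < ?n" "Hilbert_Choice.inv \<pi> i = j"
      then have "\<pi> j = i" "j < ?n"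
        using permutes_inverses(1)[OF \<pi>, of i] permutes_in_image[OF permutes_inv[OF \<pi>], of i]
        by auto
      then show "list_prod G (take (Suc i) (degrees m)) = list_prod G (take (Suc j) (degrees ?m))"
        using init by blast
    qed
  qed
  also have "\<dots> \<longleftrightarrow> (\<forall>j<?n. letter_rows \<one> (letters ?m) ! j = letter_rows \<one> (letters m) ! \<pi> j)"
  proof (intro all_cong1 imp_cong refl)
    fix j assume j: "j < ?n"
    let ?p = "list_prod G (take (\<pi> j) (degrees m))" and ?q = "list_prod G (take j (degrees ?m))"
    have j': "j < length (letters ?m)"
      using j len by simp
    have closed_pq: "?p \<in> carrier G" "?q \<in> carrier G" "snd (letters m ! \<pi> j) \<in> carrier G"
      using closed[OF m image[OF j]] closed[OF m' j'] by blast+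
    have "?p \<otimes> snd (letters m ! \<pi> j) = ?q \<otimes> snd (letters m ! \<pi> j) \<longleftrightarrow> inv ?q = inv ?p"
      using closed_pq by (metis inv_inv right_cancel)
    then show "list_prod G (take (Suc (\<pi> j)) (degrees m)) = list_prod G (take (Suc j) (degrees ?m)) \<longleftrightarrow>
        letter_rows \<one> (letters ?m) ! j = letter_rows \<one> (letters m) ! \<pi> j"
      unfolding initial[OF m image[OF j]] row[OF m image[OF j]]
        initial[OF m' j'] row[OF m' j'] letter[OF j] prod.inject by (simp del: right_cancel)
  qed
  also have "\<dots> \<longleftrightarrow> letter_rows \<one> (letters ?m) = permute_list \<pi> (letter_rows \<one> (letters m))"
    using \<pi> by (auto simp: list_eq_iff_nth_eq len permute_list_nth)
  finally show ?thesis
    by (simp add: initial_product_preserving_def)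
qed

lemma signature_permute_monom:
  assumes "m \<in> graded_monoms G" and "\<pi> permutes {..<length (letters m)}"
    and "initial_product_preserving G m \<pi>"
  shows "signature (permute_monom \<pi> m) = signature m"
  using assms initial_product_preserving_iff[OF assms(1,2)] by (simp add: signature_def)

text \<open>A bijection matching equal entries of the two lists of letters with their rows is the
  required permutation.\<close>

lemma signature_eq_imp_permute_monom:
  assumes m: "m \<in> graded_monoms G" and m': "m' \<in> graded_monoms G"
    and eq: "signature m = signature m'"
  obtains \<pi> where "\<pi> permutes {..<length (letters m)}" "m' = permute_monom \<pi> m"
    "initial_product_preserving G m \<pi>"
proof -
  let ?r = "letter_rows \<one>"
  have "mset (?r (letters m')) = mset (?r (letters m))"
    using eq by (simp add: signature_def)
  then obtain \<pi> where "\<pi> permutes {..<length (?r (letters m))}"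
    and rows: "permute_list \<pi> (?r (letters m)) = ?r (letters m')"
    by (rule mset_eq_permutation)
  then have \<pi>: "\<pi> permutes {..<length (letters m)}"
    by simp
  have "letters m' = map fst (permute_list \<pi> (?r (letters m)))"
    by (simp add: rows)
  also have "\<dots> = permute_list \<pi> (letters m)"
    using \<pi> by (simp flip: permute_list_map)
  finally have m'_eq: "m' = permute_monom \<pi> m"
    by (simp add: permute_monom_def nc_monom.expand)
  moreover have "initial_product_preserving G m \<pi>"
    using eq rows by (simp add: initial_product_preserving_iff[OF m \<pi>] signature_def flip: m'_eq)
  ultimately show ?thesis
    using that \<pi> by blast
qed

lemma binomial_identities_eq:
  "binomial_identities G n = {monom_poly m - monom_poly m' | m m'.
    m \<in> strongly_multilinear G n \<and> m' \<in> strongly_multilinear G n \<and> signature m = signature m'}"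
  (is "_ = ?D")
proof
  show "binomial_identities G n \<subseteq> ?D"
  proof
    fix f assume "f \<in> binomial_identities G n"
    then obtain m \<pi> where f: "f = monom_poly m - monom_poly (permute_monom \<pi> m)"
      and m: "m \<in> strongly_multilinear G n" and \<pi>: "\<pi> permutes {..<n}"
      and pres: "initial_product_preserving G m \<pi>"
      by (auto simp: binomial_identities_def)
    have gm: "m \<in> graded_monoms G" and len: "length (letters m) = n"
      using m by (auto simp: strongly_multilinear_def)
    have "permute_monom \<pi> m \<in> strongly_multilinear G n"
      using m \<pi> permute_monom_graded[OF gm, of \<pi>]
      by (simp add: strongly_multilinear_def permute_monom_def)
    moreover have "signature m = signature (permute_monom \<pi> m)"
      using signature_permute_monom[OF gm, of \<pi>] \<pi> len pres by simp
    ultimately show "f \<in> ?D"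
      using f m by blast
  qed
  show "?D \<subseteq> binomial_identities G n"
  proof
    fix f assume "f \<in> ?D"
    then obtain m m' where f: "f = monom_poly m - monom_poly m'"
      and m: "m \<in> strongly_multilinear G n" "m' \<in> strongly_multilinear G n"
      and eq: "signature m = signature m'"
      by auto
    have "m \<in> graded_monoms G" "m' \<in> graded_monoms G" and len: "length (letters m) = n"
      using m by (auto simp: strongly_multilinear_def)
    then obtain \<pi> where "\<pi> permutes {..<n}" "m' = permute_monom \<pi> m"
      "initial_product_preserving G m \<pi>"
      using signature_eq_imp_permute_monom[OF _ _ eq] by metis
    then show "f \<in> binomial_identities G n"
      using f m by (auto simp: binomial_identities_def)
  qed
qed


section \<open>Graded identities as combinations of differences\<close>

lemma eval_graded_monom_poly:
  assumes "graded_assignment \<sigma>" "m \<in> graded_monoms G"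
  shows "eval_poly (Coset.order G) \<sigma> (monom_poly m) = eval_monom (Coset.order G) \<sigma> m"
  by (intro eval_poly_monom_poly eval_monom_carrier graded_assignment_carrier[OF assms])

lemma subspace_graded_identities: "nc_poly.subspace (graded_identities G hs)"
proof (rule nc_poly.subspaceI)
  fix c and f g :: "(nat \<times> 'g) nc_poly"
  assume *: "f \<in> graded_identities G hs" "g \<in> graded_identities G hs"
  show "f + g \<in> graded_identities G hs"
    using * keys_add[of f g] by (auto simp: graded_identities_iff eval_poly_add)
  show "qscale c f \<in> graded_identities G hs"
    using * keys_qscale_subset[of c f] by (auto simp: graded_identities_iff eval_poly_qscale)
qed (simp add: graded_identities_iff eval_poly_zero)

lemma difference_in_graded_identities:
  assumes "m \<in> graded_monoms G" "m' \<in> graded_monoms G" "signature m = signature m'"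
  shows "monom_poly m - monom_poly m' \<in> graded_identities G hs"
proof -
  let ?f = "monom_poly m - monom_poly m'"
  have "Poly_Mapping.keys ?f \<subseteq> graded_monoms G"
    using keys_diff[of "monom_poly m" "monom_poly m'"] assms(1,2) by (auto simp: keys_monom_poly)
  moreover have "eval_poly (Coset.order G) \<sigma> ?f = 0\<^sub>m (Coset.order G) (Coset.order G)"
    if \<sigma>: "graded_assignment \<sigma>" for \<sigma>
  proof -
    have diff: "?f = monom_poly m + qscale (- 1) (monom_poly m')"
      by (simp add: qscale_monom_poly single_uminus monom_poly_def)
    have "eval_poly (Coset.order G) \<sigma> ?f =
        eval_poly (Coset.order G) \<sigma> (monom_poly m) + (- 1) \<cdot>\<^sub>m eval_poly (Coset.order G) \<sigma> (monom_poly m)"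
      unfolding diff eval_poly_add eval_poly_qscale
      using eval_monom_eq_if_signature_eq[OF \<sigma> assms]
      by (simp add: eval_graded_monom_poly[OF \<sigma>] assms(1,2) of_rat_minus)
    also have "\<dots> = 0\<^sub>m (Coset.order G) (Coset.order G)"
      by (rule eq_matI) (simp_all add: eval_poly_def)
    finally show ?thesis .
  qed
  ultimately show ?thesis
    by (simp add: graded_identities_iff)
qed

text \<open>The monomials of the differences come from \<open>f\<close> itself, so they are strongly
  multilinear whenever \<open>f\<close> is.\<close>

lemma graded_identity_in_span_differences:
  assumes "f \<in> graded_identities G hs"
  shows "f \<in> nc_poly.span {monom_poly m - monom_poly m' | m m'.
    m \<in> Poly_Mapping.keys f \<and> m' \<in> Poly_Mapping.keys f \<and> signature m = signature m'}"
  by (rule in_span_differences_if_class_sums_zero)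
    (rule graded_identity_class_sums_zero[OF assms])

lemma multilinear_graded_identities_eq_span:
  "P_space G n \<inter> graded_identities G hs = nc_poly.span (binomial_identities G n)"
proof
  have P: "P_space G n = {f. Poly_Mapping.keys f \<subseteq> strongly_multilinear G n}"
    by (simp add: P_space_def span_monom_poly)
  have graded: "strongly_multilinear G n \<subseteq> graded_monoms G"
    by (auto simp: strongly_multilinear_def)
  show "P_space G n \<inter> graded_identities G hs \<subseteq> nc_poly.span (binomial_identities G n)"
  proof
    fix f assume f: "f \<in> P_space G n \<inter> graded_identities G hs"
    have "{monom_poly m - monom_poly m' | m m'. m \<in> Poly_Mapping.keys f \<and>
        m' \<in> Poly_Mapping.keys f \<and> signature m = signature m'} \<subseteq> binomial_identities G n"
      unfolding binomial_identities_eq using f by (auto simp: P)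
    then show "f \<in> nc_poly.span (binomial_identities G n)"
      using graded_identity_in_span_differences[of f] f nc_poly.span_mono by blast
  qed
  show "nc_poly.span (binomial_identities G n) \<subseteq> P_space G n \<inter> graded_identities G hs"
  proof (rule nc_poly.span_minimal)
    show "binomial_identities G n \<subseteq> P_space G n \<inter> graded_identities G hs"
    proof
      fix f assume "f \<in> binomial_identities G n"
      then obtain m m' where f: "f = monom_poly m - monom_poly m'"
        and m: "m \<in> strongly_multilinear G n" "m' \<in> strongly_multilinear G n"
        and eq: "signature m = signature m'"
        by (auto simp: binomial_identities_eq)
      have "f \<in> P_space G n"
        unfolding f P_space_def by (intro nc_poly.span_diff nc_poly.span_base imageI m)
      then show "f \<in> P_space G n \<inter> graded_identities G hs"
        using f difference_in_graded_identities[OF _ _ eq] m graded by auto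
    qed
    show "nc_poly.subspace (P_space G n \<inter> graded_identities G hs)"
      by (intro nc_poly.subspace_inter subspace_graded_identities)
        (simp add: P_space_def)
  qed
qed


section \<open>The graded identities form a T-ideal\<close>

lemma carrier_free_alg: "f \<in> carrier (free_alg G) \<longleftrightarrow> Poly_Mapping.keys f \<subseteq> graded_monoms G"
  by (simp add: free_alg_def)

lemma free_alg_simps [simp]:
  "(\<otimes>\<^bsub>free_alg G\<^esub>) = (*)" "(\<oplus>\<^bsub>free_alg G\<^esub>) = (+)"
  "\<one>\<^bsub>free_alg G\<^esub> = 1" "\<zero>\<^bsub>free_alg G\<^esub> = 0"
  by (simp_all add: free_alg_def)

lemma keys_mult_graded:
  assumes "Poly_Mapping.keys f \<subseteq> graded_monoms G" "Poly_Mapping.keys g \<subseteq> graded_monoms G"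
  shows "Poly_Mapping.keys (f * g) \<subseteq> graded_monoms G"
  using keys_mult[of f g] assms by (fastforce simp: graded_monoms_def plus_nc_monom_def)

lemma zero_in_graded_monoms: "0 \<in> graded_monoms G"
  by (simp add: graded_monoms_def zero_nc_monom_def)

lemma ring_free_alg: "ring (free_alg G)"
proof (rule ringI)
  show "abelian_group (free_alg G)"
  proof (rule abelian_groupI)
    fix f assume f: "f \<in> carrier (free_alg G)"
    show "\<exists>g\<in>carrier (free_alg G). g \<oplus>\<^bsub>free_alg G\<^esub> f = \<zero>\<^bsub>free_alg G\<^esub>"
      by (rule bexI[of _ "- f"]) (use f in \<open>simp_all add: carrier_free_alg\<close>)
  next
    fix f g assume "f \<in> carrier (free_alg G)" "g \<in> carrier (free_alg G)"
    then show "f \<oplus>\<^bsub>free_alg G\<^esub> g \<in> carrier (free_alg G)"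
      using keys_add[of f g] by (auto simp: carrier_free_alg)
  qed (simp_all add: carrier_free_alg ac_simps)
  show "monoid (free_alg G)"
    by (rule monoidI)
      (use keys_mult_graded in \<open>simp_all add: carrier_free_alg mult.assoc zero_in_graded_monoms\<close>)
qed (simp_all add: distrib_left distrib_right)

lemma eval_poly_mult_graded:
  assumes "graded_assignment \<sigma>"
    and "Poly_Mapping.keys f \<subseteq> graded_monoms G" "Poly_Mapping.keys g \<subseteq> graded_monoms G"
  shows "eval_poly (Coset.order G) \<sigma> (f * g) =
    eval_poly (Coset.order G) \<sigma> f * eval_poly (Coset.order G) \<sigma> g"
  by (rule eval_poly_mult[OF graded_assignment_carrier[OF assms(1)] assms(2,3)])

lemma ideal_graded_identities: "ideal (graded_identities G hs) (free_alg G)"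
proof (rule idealI[OF ring_free_alg])
  interpret ring "free_alg G" by (rule ring_free_alg)
  have neg: "- f \<in> graded_identities G hs" if "f \<in> graded_identities G hs" for f
    using nc_poly.subspace_neg[OF subspace_graded_identities that] .
  show "subgroup (graded_identities G hs) (add_monoid (free_alg G))"
  proof (rule add.subgroupI)
    show "graded_identities G hs \<subseteq> carrier (free_alg G)"
      by (auto simp: graded_identities_def)
    show "graded_identities G hs \<noteq> {}"
      using nc_poly.subspace_0[OF subspace_graded_identities] by blast
    fix f assume f: "f \<in> graded_identities G hs"
    then have "\<ominus>\<^bsub>free_alg G\<^esub> f = - f"
      using neg[OF f] by (intro minus_equality) (auto simp: graded_identities_def)
    then show "\<ominus>\<^bsub>free_alg G\<^esub> f \<in> graded_identities G hs"
      using neg[OF f] by simp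
    fix g assume "g \<in> graded_identities G hs"
    then show "f \<oplus>\<^bsub>free_alg G\<^esub> g \<in> graded_identities G hs"
      using nc_poly.subspace_add[OF subspace_graded_identities f] by simp
  qed
next
  fix f g assume f: "f \<in> graded_identities G hs" and g: "g \<in> carrier (free_alg G)"
  have keys: "Poly_Mapping.keys f \<subseteq> graded_monoms G" "Poly_Mapping.keys g \<subseteq> graded_monoms G"
    using f g by (auto simp: graded_identities_iff carrier_free_alg)
  have "eval_poly (Coset.order G) \<sigma> (g * f) = 0\<^sub>m (Coset.order G) (Coset.order G)"
    "eval_poly (Coset.order G) \<sigma> (f * g) = 0\<^sub>m (Coset.order G) (Coset.order G)"
    if \<sigma>: "graded_assignment \<sigma>" for \<sigma>
    using f \<sigma> left_mult_zero_mat[OF eval_poly_carrier] right_mult_zero_mat[OF eval_poly_carrier]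
    by (simp_all add: eval_poly_mult_graded[OF \<sigma>] keys graded_identities_iff)
  then show "g \<otimes>\<^bsub>free_alg G\<^esub> f \<in> graded_identities G hs"
    and "f \<otimes>\<^bsub>free_alg G\<^esub> g \<in> graded_identities G hs"
    using keys_mult_graded keys by (simp_all add: graded_identities_iff)
qed

lemma eval_free_component:
  assumes \<sigma>: "graded_assignment \<sigma>" and f: "f \<in> free_component G g"
  shows "eval_poly (Coset.order G) \<sigma> f \<in> crossed_component G hs g"
proof -
  let ?k = "Coset.order G"
  obtain a where a: "\<And>v. v \<in> {1..} \<times> carrier G \<Longrightarrow> \<sigma> v = weighted_perm (snd v) (a v)"
    using graded_assignment_weights[OF \<sigma>] by blast
  have keys: "m \<in> graded_monoms G" "list_prod G (degrees m) = g" if "m \<in> Poly_Mapping.keys f" for m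
    using f that by (auto simp: free_component_def carrier_free_alg)
  have val: "eval_monom ?k \<sigma> m = weighted_perm g (\<lambda>h. \<Prod>(v, x)\<leftarrow>letter_rows h (letters m). a v x)"
    if "m \<in> Poly_Mapping.keys f" for m
    using eval_graded_monom[of \<sigma> a m] a keys[OF that] by simp
  let ?d = "\<lambda>h. \<Sum>m\<in>Poly_Mapping.keys f. of_rat (Poly_Mapping.lookup f m) *
    (\<Prod>(v, x)\<leftarrow>letter_rows h (letters m). a v x)"
  have "eval_poly ?k \<sigma> f = weighted_perm g ?d"
    by (rule eq_matI) (simp_all add: eval_poly_def val weighted_perm_def)
  then show ?thesis
    by (subst crossed_component_iff) (intro exI[of _ ?d])
qed

text \<open>A graded endomorphism followed by a graded evaluation is again a graded evaluation,
  namely the one at the values of the images of the variables.\<close>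

lemma eval_graded_endomorphism:
  assumes \<sigma>: "graded_assignment \<sigma>" and \<phi>: "graded_endomorphism G \<phi>"
  obtains \<tau> where "graded_assignment \<tau>"
    and "\<And>f. f \<in> carrier (free_alg G) \<Longrightarrow>
      eval_poly (Coset.order G) \<sigma> (\<phi> f) = eval_poly (Coset.order G) \<tau> f"
proof
  let ?k = "Coset.order G"
  define \<tau> where "\<tau> v = eval_poly ?k \<sigma> (\<phi> (monom_poly (Monom [v])))" for v
  have hom: "\<phi> \<in> Ring.ring_hom (free_alg G) (free_alg G)"
    using \<phi> by (simp add: graded_endomorphism_def)
  have closed: "Poly_Mapping.keys (\<phi> f) \<subseteq> graded_monoms G"
    if "Poly_Mapping.keys f \<subseteq> graded_monoms G" for f
    using ring_hom_closed[OF hom] that by (simp add: carrier_free_alg)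
  have add: "\<phi> (f + g) = \<phi> f + \<phi> g" and mult: "\<phi> (f * g) = \<phi> f * \<phi> g"
    if "Poly_Mapping.keys f \<subseteq> graded_monoms G" "Poly_Mapping.keys g \<subseteq> graded_monoms G" for f g
    using ring_hom_add[OF hom, of f g] ring_hom_mult[OF hom, of f g] that
    by (simp_all add: carrier_free_alg)
  have scale: "\<phi> (qscale c f) = qscale c (\<phi> f)"
    if "Poly_Mapping.keys f \<subseteq> graded_monoms G" for c f
    using \<phi> that by (simp add: graded_endomorphism_def carrier_free_alg)
  show \<tau>: "graded_assignment \<tau>"
    unfolding graded_assignment_def
  proof (intro allI ballI impI)
    fix i :: nat and g assume ig: "1 \<le> i" "g \<in> carrier G"
    then have "monom_poly (Monom [(i, g)]) \<in> free_component G g"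
      by (simp add: free_component_def carrier_free_alg keys_monom_poly graded_monoms_def
          degrees_def list_prod_def)
    then have "\<phi> (monom_poly (Monom [(i, g)])) \<in> free_component G g"
      using \<phi> ig(2) unfolding graded_endomorphism_def by blast
    then show "\<tau> (i, g) \<in> crossed_component G hs g"
      unfolding \<tau>_def by (rule eval_free_component[OF \<sigma>])
  qed
  have endo_monom: "eval_poly ?k \<sigma> (\<phi> (monom_poly (Monom vs))) = eval_monom ?k \<tau> (Monom vs)"
    if "set vs \<subseteq> {1..} \<times> carrier G" for vs
    using that
  proof (induction vs)
    case Nil
    have "\<phi> (monom_poly 0) = monom_poly 0"
      using ring_hom_one[OF hom] by (simp add: monom_poly_zero)
    then show ?case
      using eval_graded_monom_poly[OF \<sigma> zero_in_graded_monoms] by (simp add: eval_monom_zero flip: zero_nc_monom_def)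
  next
    case (Cons v vs)
    have keys: "Poly_Mapping.keys (monom_poly (Monom [v])) \<subseteq> graded_monoms G"
      "Poly_Mapping.keys (monom_poly (Monom vs)) \<subseteq> graded_monoms G"
      using Cons.prems by (auto simp: keys_monom_poly graded_monoms_def)
    have "monom_poly (Monom (v # vs)) = monom_poly (Monom [v]) * monom_poly (Monom vs)"
      by (simp add: plus_nc_monom_def flip: monom_poly_plus)
    then show ?case
      using Cons keys
      by (simp add: mult eval_poly_mult_graded[OF \<sigma>] closed eval_monom_Cons flip: \<tau>_def)
  qed
  show "eval_poly ?k \<sigma> (\<phi> f) = eval_poly ?k \<tau> f" if "f \<in> carrier (free_alg G)" for f
    using that unfolding carrier_free_alg
  proof (induction f rule: nc_poly_induct)
    case zero
    have "\<phi> 0 = 0"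
      using scale[of 0 0] by simp
    then show ?case by (simp add: eval_poly_zero)
  next
    case (monom m)
    then show ?case
      using endo_monom[of "letters m"] by (simp add: eval_graded_monom_poly[OF \<tau>] graded_monoms_def)
  qed (simp_all add: add scale eval_poly_add eval_poly_qscale)
qed

lemma T_ideal_graded_identities: "T_ideal G (graded_identities G hs)"
  unfolding T_ideal_def
proof (intro conjI ideal_graded_identities allI impI subsetI)
  fix \<phi> g assume \<phi>: "graded_endomorphism G \<phi>" and "g \<in> \<phi> ` graded_identities G hs"
  then obtain f where f: "f \<in> graded_identities G hs" and g: "g = \<phi> f"
    by blast
  have fc: "f \<in> carrier (free_alg G)"
    using f by (simp add: graded_identities_def)
  have "\<phi> f \<in> carrier (free_alg G)"
    using \<phi> ring_hom_closed[OF _ fc] by (auto simp: graded_endomorphism_def)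
  moreover have "eval_poly (Coset.order G) \<sigma> (\<phi> f) = 0\<^sub>m (Coset.order G) (Coset.order G)"
    if "graded_assignment \<sigma>" for \<sigma>
    using eval_graded_endomorphism[OF that \<phi>] f fc by (metis graded_identities_iff)
  ultimately show "g \<in> graded_identities G hs"
    by (simp add: g graded_identities_iff carrier_free_alg)
qed


section \<open>Generation of the T-ideal by relabelling indices\<close>

text \<open>The endomorphism \<open>x_{i,g} \<mapsto> x_{\<rho> i,g}\<close>.\<close>

definition relabel :: "(nat \<Rightarrow> nat) \<Rightarrow> (nat \<times> 'g) nc_poly \<Rightarrow> (nat \<times> 'g) nc_poly" where
  "relabel \<rho> f = (\<Sum>m\<in>Poly_Mapping.keys f.
     Poly_Mapping.single (map_nc_monom (map_prod \<rho> id) m) (Poly_Mapping.lookup f m))"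

lemma relabel_monom_poly:
  "relabel \<rho> (monom_poly m) = monom_poly (map_nc_monom (map_prod \<rho> id) m)"
  by (simp add: relabel_def monom_poly_def)

lemma relabel_add: "relabel \<rho> (f + g) = relabel \<rho> f + relabel \<rho> g"
  unfolding relabel_def by (rule setsum_keys_plus_distrib) (simp_all add: single_add)

lemma relabel_qscale: "relabel \<rho> (qscale c f) = qscale c (relabel \<rho> f)"
  unfolding relabel_def
  by (subst sum_keys_qscale) (simp_all add: qscale_def sum_distrib_left mult_single)

lemma relabel_diff: "relabel \<rho> (f - g) = relabel \<rho> f - relabel \<rho> g"
  using relabel_add[of \<rho> "f - g" g] by simp

lemma letters_map_nc_monom: "letters (map_nc_monom \<theta> m) = map \<theta> (letters m)"
  by (cases m) simp

lemma map_nc_monom_plus: "map_nc_monom \<theta> (u + w) = map_nc_monom \<theta> u + map_nc_monom \<theta> w"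
  by (simp add: plus_nc_monom_def letters_map_nc_monom)

lemma relabel_mult: "relabel \<rho> (f * g) = relabel \<rho> f * relabel \<rho> g"
proof -
  have zero: "relabel \<rho> 0 = 0"
    by (simp add: relabel_def)
  have left_monom: "relabel \<rho> (monom_poly u * g) = relabel \<rho> (monom_poly u) * relabel \<rho> g" for u
  proof -
    have "Poly_Mapping.keys g \<subseteq> UNIV" by simp
    then show ?thesis
    proof (induction g rule: nc_poly_induct)
      case (monom w)
      show ?case
        by (simp add: relabel_monom_poly map_nc_monom_plus flip: monom_poly_plus)
    qed (simp_all add: zero distrib_left relabel_add relabel_qscale qscale_mult_right)
  qed
  have "Poly_Mapping.keys f \<subseteq> UNIV" by simp
  then show ?thesis
    by (induction f rule: nc_poly_induct)
      (simp_all add: zero left_monom distrib_right relabel_add relabel_qscale qscale_mult_left)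
qed

lemma degrees_relabel: "degrees (map_nc_monom (map_prod \<rho> id) m) = degrees m"
  by (simp add: degrees_def letters_map_nc_monom comp_def)

lemma keys_relabel:
  "Poly_Mapping.keys (relabel \<rho> f) \<subseteq> map_nc_monom (map_prod \<rho> id) ` Poly_Mapping.keys f"
  unfolding relabel_def by (rule subset_trans[OF keys_sum]) auto

lemma graded_endomorphism_relabel:
  assumes \<rho>: "\<And>i. 1 \<le> i \<Longrightarrow> 1 \<le> \<rho> i"
  shows "graded_endomorphism G (relabel \<rho>)"
proof -
  have graded: "map_nc_monom (map_prod \<rho> id) m \<in> graded_monoms G" if "m \<in> graded_monoms G" for m
    using that \<rho> by (auto simp: graded_monoms_def letters_map_nc_monom subset_iff mem_Times_iff)
  have closed: "relabel \<rho> f \<in> carrier (free_alg G)" if "f \<in> carrier (free_alg G)" for f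
    using that keys_relabel[of \<rho> f] graded unfolding carrier_free_alg by blast
  have "relabel \<rho> \<in> Ring.ring_hom (free_alg G) (free_alg G)"
  proof (rule ring_hom_memI)
    show "relabel \<rho> \<one>\<^bsub>free_alg G\<^esub> = \<one>\<^bsub>free_alg G\<^esub>"
      using relabel_monom_poly[of \<rho> 0] by (simp add: zero_nc_monom_def flip: monom_poly_zero)
  qed (simp_all add: closed relabel_mult relabel_add)
  moreover have "relabel \<rho> ` free_component G g \<subseteq> free_component G g" for g
  proof (rule image_subsetI)
    fix f assume f: "f \<in> free_component G g"
    have "list_prod G (degrees m) = g" if "m \<in> Poly_Mapping.keys (relabel \<rho> f)" for m
    proof -
      obtain u where "u \<in> Poly_Mapping.keys f" "m = map_nc_monom (map_prod \<rho> id) u"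
        using \<open>m \<in> _\<close> keys_relabel[of \<rho> f] by blast
      then show ?thesis
        using f by (simp add: degrees_relabel free_component_def)
    qed
    then show "relabel \<rho> f \<in> free_component G g"
      using f closed by (simp add: free_component_def)
  qed
  ultimately show ?thesis
    by (simp add: graded_endomorphism_def relabel_qscale)
qed

text \<open>Multiplication by a rational scalar is multiplication by a constant polynomial.\<close>

lemma subspace_T_ideal:
  assumes "T_ideal G J"
  shows "nc_poly.subspace J"
proof -
  interpret J: ideal J "free_alg G"
    using assms by (simp add: T_ideal_def)
  show ?thesis
  proof (rule nc_poly.subspaceI)
    show "0 \<in> J" using additive_subgroup.zero_closed[OF J.additive_subgroup_axioms] by simp
    show "f + g \<in> J" if "f \<in> J" "g \<in> J" for f g
      using additive_subgroup.a_closed[OF J.additive_subgroup_axioms that] by simp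
    show "qscale c f \<in> J" if "f \<in> J" for c f
      using J.I_l_closed[OF that, of "Poly_Mapping.single 0 c"]
      by (simp add: qscale_def carrier_free_alg zero_in_graded_monoms)
  qed
qed

text \<open>Initial product preservation depends on the degrees only. Numbering the letters of
  \<open>m\<close> by their positions gives a strongly multilinear monomial, and restoring the original
  indices maps its binomial identity to the given difference.\<close>

lemma difference_in_T_ideal:
  assumes J: "T_ideal G J" and binomials: "(\<Union>n\<in>{1..}. binomial_identities G n) \<subseteq> J"
    and m: "m \<in> graded_monoms G" and m': "m' \<in> graded_monoms G"
    and eq: "signature m = signature m'"
  shows "monom_poly m - monom_poly m' \<in> J"
proof -
  obtain \<pi> where \<pi>: "\<pi> permutes {..<length (letters m)}" and m'_eq: "m' = permute_monom \<pi> m"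
    and pres: "initial_product_preserving G m \<pi>"
    using signature_eq_imp_permute_monom[OF m m' eq] by blast
  define n where "n = length (letters m)"
  show ?thesis
  proof (cases "n = 0")
    case True
    then have "m' = m"
      by (cases m) (simp add: n_def m'_eq permute_monom_def)
    then show ?thesis
      using nc_poly.subspace_0[OF subspace_T_ideal[OF J]] by simp
  next
    case False
    define u where "u = Monom (zip [1..<Suc n] (degrees m))"
    have len: "length (letters u) = n"
      by (simp add: u_def n_def degrees_def del: upt_Suc)
    have deg: "degrees u = degrees m"
      by (simp add: u_def n_def degrees_def del: upt_Suc)
    have "fst ` set (letters u) = set (map fst (letters u))"
      by simp
    also have "\<dots> = {1..n}"
      by (auto simp: u_def degrees_def n_def simp del: set_map upt_Suc)
    finally have fst_u: "fst ` set (letters u) = {1..n}" .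
    moreover have "snd ` set (letters u) \<subseteq> carrier G"
      using degrees_closed[OF m] unfolding deg[symmetric] by (simp add: degrees_def)
    ultimately have u: "u \<in> strongly_multilinear G n"
      using len by (force simp: strongly_multilinear_def graded_monoms_def)
    have "initial_product_preserving G u \<pi>"
      using pres \<pi> len deg
      by (simp add: initial_product_preserving_def degrees_permute_monom n_def)
    then have "monom_poly u - monom_poly (permute_monom \<pi> u) \<in> binomial_identities G n"
      using u \<pi> by (auto simp: binomial_identities_def n_def)
    then have u_J: "monom_poly u - monom_poly (permute_monom \<pi> u) \<in> J"
      using binomials False by force
    \<comment> \<open>Outside the indices of the numbered monomial the relabelling only has to stay positive.\<close>
    define \<rho> where "\<rho> i = (if i \<in> {1..n} then fst (letters m ! (i - 1)) else 1)" for i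
    have "letters m ! t \<in> {1..} \<times> carrier G" if "t < n" for t
      using m nth_mem[of t "letters m"] that unfolding n_def graded_monoms_def by blast
    then have "1 \<le> \<rho> i" for i
      by (auto simp: \<rho>_def mem_Times_iff)
    then have "graded_endomorphism G (relabel \<rho>)"
      by (intro graded_endomorphism_relabel)
    then have "relabel \<rho> (monom_poly u - monom_poly (permute_monom \<pi> u)) \<in> J"
      using J u_J by (auto simp: T_ideal_def)
    moreover have restore: "map (map_prod \<rho> id) (letters u) = letters m"
      by (rule nth_equalityI) (auto simp: u_def n_def degrees_def \<rho>_def prod_eq_iff simp del: upt_Suc)
    then have "map_nc_monom (map_prod \<rho> id) u = m"
      by (simp add: nc_monom.expand letters_map_nc_monom)
    moreover have "map_nc_monom (map_prod \<rho> id) (permute_monom \<pi> u) = m'"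
      using \<pi> len restore
      by (simp add: m'_eq permute_monom_def n_def flip: permute_list_map)
    ultimately show ?thesis
      by (simp add: relabel_diff relabel_monom_poly)
  qed
qed

lemma generates_T_ideal_graded_identities:
  "generates_T_ideal G (\<Union>n\<in>{1..}. binomial_identities G n) (graded_identities G hs)"
  unfolding generates_T_ideal_def
proof (intro conjI allI impI T_ideal_graded_identities)
  show "(\<Union>n\<in>{1..}. binomial_identities G n) \<subseteq> graded_identities G hs"
  proof (rule UN_least)
    show "binomial_identities G n \<subseteq> graded_identities G hs" for n
      using multilinear_graded_identities_eq_span[of n]
        nc_poly.span_superset[of "binomial_identities G n"] by blast
  qed
  fix J assume J: "T_ideal G J \<and> (\<Union>n\<in>{1..}. binomial_identities G n) \<subseteq> J"
  show "graded_identities G hs \<subseteq> J"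
  proof
    fix f assume f: "f \<in> graded_identities G hs"
    let ?D = "{monom_poly m - monom_poly m' | m m'. m \<in> Poly_Mapping.keys f \<and>
        m' \<in> Poly_Mapping.keys f \<and> signature m = signature m'}"
    have keys: "Poly_Mapping.keys f \<subseteq> graded_monoms G"
      using f by (simp add: graded_identities_iff)
    have "?D \<subseteq> J"
    proof
      fix d assume "d \<in> ?D"
      then obtain m m' where d: "d = monom_poly m - monom_poly m'"
        and m: "m \<in> Poly_Mapping.keys f" "m' \<in> Poly_Mapping.keys f"
        and eq: "signature m = signature m'"
        by blast
      show "d \<in> J"
        unfolding d using J keys m eq by (intro difference_in_T_ideal) auto
    qed
    moreover have "nc_poly.subspace J"
      using J by (intro subspace_T_ideal) blast
    ultimately have "nc_poly.span ?D \<subseteq> J"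
      by (rule nc_poly.span_minimal)
    then show "f \<in> J"
      using graded_identity_in_span_differences[OF f] by (rule subsetD)
  qed
qed

end


section \<open>Binomial identities generate the graded identities\<close>

theorem corollary3:
  fixes G :: "('g, 'm) monoid_scheme" and hs :: "'g list"
  assumes "group G" and "finite (carrier G)"
    and "distinct hs" and "set hs = carrier G"
  shows "(\<forall>n\<ge>1. P_space G n \<inter> graded_identities G hs = nc_poly.span (binomial_identities G n))
    \<and> generates_T_ideal G (\<Union>n\<in>{1..}. binomial_identities G n) (graded_identities G hs)"
proof -
  interpret group G by fact
  interpret enumerated_group G hs
    by unfold_locales fact+
  show ?thesis
    using multilinear_graded_identities_eq_span generates_T_ideal_graded_identities by blast
qed

end
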